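(* Let $d \geq 1$ and let $A, a > 0$. There is a constant $C > 0$, depending only on $A$, $a$ and $d$, such that for all $x \in \mathbf{R}^d$ and all $u \in C_{\mathrm{c}}(\mathbf{R}^d)$, $$\sup_{(y,t) \in \Gamma_x^{(A,a)}} |\mathrm{e}^{t^2 L} u(y)| \leq C \, \sup_{r > 0} \frac{1}{\gamma(B_r(x))} \int_{B_r(x)} |u| \, \mathrm{d}\gamma .$$
   Context: $C_{\mathrm{c}}(\mathbf{R}^d)$ is the space of continuous compactly supported functions on $\mathbf{R}^d$. $B_r(x)$ is the open Euclidean ball with center $x$ and radius $r$. The Gaussian measure $\gamma$ on $\mathbf{R}^d$ is $\mathrm{d}\gamma(x) = \pi^{-d/2} \mathrm{e}^{-|x|^2} \, \mathrm{d}\lambda(x)$, where $\lambda$ is Lebesgue measure. Set $m(x) := \min\{1, 1/|x|\}$ for $x \in \mathbf{R}^d$ (with $m(0) = 1$), and $\mathbf{R}^{d+1}_+ = \mathbf{R}^d \times (0,\infty)$. The Gaussian cone with aperture $A$ and cut-off parameter $a$ is $$\Gamma_x^{(A,a)} := \{(y,t) \in \mathbf{R}^{d+1}_+ : |x-y| < At \text{ and } t \leq a\, m(x)\}.$$ $L := \frac12 \Delta - \langle x, \nabla\rangle$ is the Ornstein-Uhlenbeck operator, and $(\mathrm{e}^{tL})_{t \geq 0}$ is the Ornstein-Uhlenbeck semigroup, which for $t > 0$ is given by $$\mathrm{e}^{tL} u(x) = \int_{\mathbf{R}^d} M_t(x,\xi)\, u(\xi) \, \mathrm{d}\gamma(\xi),$$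 where $M_t$ is the Mehler kernel $$M_t(x,\xi) = \frac{1}{(1-\mathrm{e}^{-2t})^{d/2}} \exp\Bigl(-\frac{|\mathrm{e}^{-t}x - \xi|^2}{1-\mathrm{e}^{-2t}}\Bigr) \mathrm{e}^{|\xi|^2}.$$ Thus $\mathrm{e}^{t^2L}u(y) = \int_{\mathbf{R}^d} M_{t^2}(y,\xi) u(\xi)\,\mathrm{d}\gamma(\xi)$. *)

theory Defs
  imports "HOL-Analysis.Analysis"
begin

definition gauss_measure :: "'a::euclidean_space measure" where
  "gauss_measure =
     density lborel (\<lambda>x. ennreal (pi powr (- (real DIM('a) / 2)) * exp (- (norm x)\<^sup>2)))"

(* The case distinction is needed because 1 / 0 = 0 in HOL. *)
definition cutoff :: "'a::euclidean_space \<Rightarrow> real" where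
  "cutoff x = (if x = 0 then 1 else min 1 (1 / norm x))"

definition gauss_cone :: "real \<Rightarrow> real \<Rightarrow> 'a::euclidean_space \<Rightarrow> ('a \<times> real) set" where
  "gauss_cone A a x = {(y, t). 0 < t \<and> norm (x - y) < A * t \<and> t \<le> a * cutoff x}"

definition mehler_kernel :: "real \<Rightarrow> 'a::euclidean_space \<Rightarrow> 'a \<Rightarrow> real" where
  "mehler_kernel t x \<xi> =
     1 / (1 - exp (- 2 * t)) powr (real DIM('a) / 2)
       * exp (- ((norm (exp (- t) *\<^sub>R x - \<xi>))\<^sup>2 / (1 - exp (- 2 * t))))
       * exp ((norm \<xi>)\<^sup>2)"

(* The Ornstein-Uhlenbeck semigroup exp (t L) with L = (1/2) Laplace - <x, grad>, in its
   kernel representation, which is meaningful for t > 0 only. *)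
definition ou_semigroup ::
    "real \<Rightarrow> ('a::euclidean_space \<Rightarrow> 'b::{banach, second_countable_topology}) \<Rightarrow> 'a \<Rightarrow> 'b" where
  "ou_semigroup t u x = (LINT \<xi>|gauss_measure. mehler_kernel t x \<xi> *\<^sub>R u \<xi>)"

definition Cc :: "('a::euclidean_space \<Rightarrow> 'b::real_normed_vector) set" where
  "Cc = {u. continuous_on UNIV u \<and> compact (closure {x. u x \<noteq> 0})}"

end

(* For (y, t) in the cone put s = 1 - exp (-2 t^2); then s is comparable to t^2 and bounded away
   from 1, while sqrt s |x| and |x - exp (-t^2) y| / sqrt s are bounded. Expanding
   |xi|^2 <= (|x| + |xi - x|)^2 therefore gives, for every b,
     M_{t^2}(y, xi) <= C_b s^(-d/2) exp (|x|^2) exp (-b |xi - x| / sqrt s).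
   This is dominated by a sum over k of multiples of the indicators of the balls of radius
   (k + 1) sqrt s about x, whose Gaussian measures are at most
   C s^(d/2) exp (-|x|^2) (k + 1)^d exp (4 a (k + 1)). For b large the resulting averages of |u|
   carry weights bounded by a geometric series. *)
theory Submission
  imports Defs
begin

lemma sets_gauss_measure [simp, measurable_cong]: "sets gauss_measure = sets borel"
  by (simp add: gauss_measure_def)

text \<open>The density is strictly positive, so a Gaussian-null ball would be Lebesgue-null. This
  keeps the averages over balls from degenerating to the default \<open>1 / 0 = 0\<close>.\<close>

lemma emeasure_gauss_ball_pos:
  fixes x :: "'a::euclidean_space"
  assumes "r > 0"
  shows "emeasure gauss_measure (ball x r) > 0"
proof (rule ccontr)
  assume "\<not> ?thesis"
  then have "ball x r \<in> null_sets gauss_measure"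
    by (simp add: null_sets_def)
  then have "AE y in lborel. y \<notin> ball x r"
    unfolding gauss_measure_def by (subst (asm) null_sets_density_iff) auto
  then have "ball x r \<in> null_sets lborel"
    by (subst (asm) AE_iff_null_sets[symmetric]) auto
  then show False
    using assms emeasure_ball[of r x] unit_ball_vol_pos[of "real DIM('a)"]
    by (simp add: null_sets_def)
qed

text \<open>The density is bounded pointwise on the ball: expanding
  \<open>(norm x - norm y)^2 >= 0\<close> leaves a term linear in \<open>r\<close>. Its factor
  \<open>norm x * r\<close> will be controlled by the cut-off of the cone.\<close>

lemma emeasure_gauss_ball_le:
  fixes x :: "'a::euclidean_space"
  assumes "r \<ge> 0"
  shows "emeasure gauss_measure (ball x r) \<le>
    ennreal (pi powr (- (real DIM('a) / 2)) * exp (2 * norm x * r - (norm x)\<^sup>2) *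
      (unit_ball_vol (real DIM('a)) * r ^ DIM('a)))"
proof -
  let ?p = "pi powr (- (real DIM('a) / 2))"
  let ?E = "exp (2 * norm x * r - (norm x)\<^sup>2)"
  have le: "- (norm y)\<^sup>2 \<le> 2 * norm x * r - (norm x)\<^sup>2" if "y \<in> ball x r" for y
  proof -
    have "norm x - norm y \<le> r"
      using that norm_triangle_ineq2[of x y] by (simp add: dist_norm)
    then have "norm x * (norm x - norm y) \<le> norm x * r"
      by (rule mult_left_mono) simp
    moreover have "0 \<le> (norm x - norm y)\<^sup>2"
      by simp
    ultimately show ?thesis
      by (simp add: power2_eq_square algebra_simps)
  qed
  have "emeasure gauss_measure (ball x r) =
      (\<integral>\<^sup>+y. ennreal (?p * exp (- (norm y)\<^sup>2)) * indicator (ball x r) y \<partial>lborel)"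
    unfolding gauss_measure_def by (subst emeasure_density) auto
  also have "\<dots> \<le> (\<integral>\<^sup>+y. ennreal (?p * ?E) * indicator (ball x r) y \<partial>lborel)"
    using le by (intro nn_integral_mono) (auto simp: indicator_def intro!: ennreal_leI)
  also have "\<dots> = ennreal (?p * ?E) * emeasure lborel (ball x r)"
    by (subst nn_integral_cmult_indicator) auto
  also have "\<dots> = ennreal (?p * ?E * (unit_ball_vol (real DIM('a)) * r ^ DIM('a)))"
    using assms by (simp add: emeasure_ball ennreal_mult)
  finally show ?thesis .
qed

lemma emeasure_gauss_ball_finite:
  fixes x :: "'a::euclidean_space"
  assumes "r \<ge> 0"
  shows "emeasure gauss_measure (ball x r) < \<infinity>"
  using emeasure_gauss_ball_le[OF assms, of x] by (simp add: order_le_less_trans)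

text \<open>The right-hand side isolates the average that the maximal function bounds. Continuity
  makes \<open>u\<close> bounded on the closed ball, hence integrable on the open one, so the
  Bochner integral is not the default 0.\<close>

lemma nn_integral_gauss_ball:
  fixes u :: "'a::euclidean_space \<Rightarrow> 'b::{banach, second_countable_topology}"
  assumes "continuous_on UNIV u" and "r > 0"
  shows "(\<integral>\<^sup>+y. ennreal (norm (u y)) * indicator (ball x r) y \<partial>gauss_measure) =
    emeasure gauss_measure (ball x r) *
      ennreal (1 / measure gauss_measure (ball x r) * (LINT y:ball x r|gauss_measure. norm (u y)))"
proof -
  let ?f = "\<lambda>y. indicator (ball x r) y *\<^sub>R norm (u y)"
  have [measurable]: "u \<in> borel_measurable borel"
    using assms(1) by (rule borel_measurable_continuous_onI)
  have fin: "emeasure gauss_measure (ball x r) < \<infinity>"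
    using assms(2) by (intro emeasure_gauss_ball_finite) simp
  have "compact (u ` cball x r)"
    using assms(1) by (intro compact_continuous_image continuous_on_subset[OF assms(1)]) auto
  then obtain B where B: "norm (u y) \<le> B" if "y \<in> cball x r" for y
    by (metis bounded_iff compact_imp_bounded imageI)
  have int: "integrable gauss_measure ?f"
    by (rule integrableI_bounded_set[where A = "ball x r" and B = B])
       (use fin B in \<open>auto simp: indicator_def\<close>)
  have m: "emeasure gauss_measure (ball x r) = ennreal (measure gauss_measure (ball x r))"
    using fin by (intro emeasure_eq_ennreal_measure) auto
  then have pos: "measure gauss_measure (ball x r) > 0"
    using emeasure_gauss_ball_pos[OF assms(2), of x] by simp
  have "(\<integral>\<^sup>+y. ennreal (norm (u y)) * indicator (ball x r) y \<partial>gauss_measure) =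
      (\<integral>\<^sup>+y. ennreal (?f y) \<partial>gauss_measure)"
    by (intro nn_integral_cong) (auto simp: indicator_def)
  also have "\<dots> = ennreal (LINT y:ball x r|gauss_measure. norm (u y))"
    unfolding set_lebesgue_integral_def by (intro nn_integral_eq_integral int) auto
  also have "\<dots> = ennreal (measure gauss_measure (ball x r) *
      (1 / measure gauss_measure (ball x r) * (LINT y:ball x r|gauss_measure. norm (u y))))"
    using pos by simp
  also have "\<dots> = emeasure gauss_measure (ball x r) *
      ennreal (1 / measure gauss_measure (ball x r) * (LINT y:ball x r|gauss_measure. norm (u y)))"
    unfolding m by (intro ennreal_mult') simp
  finally show ?thesis .
qed

text \<open>\<open>H\<close> collects the coefficients linear in the scaled distance: one part from
  the displaced centre of the Gaussian factor, \<open>4 * a\<close> from expanding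
  \<open>(norm \<xi>)^2\<close>. The rate \<open>b\<close> stays free so that it can later beat the
  growth of the measures of balls.\<close>

lemma mehler_kernel_le:
  fixes x y \<xi> :: "'a::euclidean_space"
  assumes "A > 0" "a > 0" and yt: "(y, t) \<in> gauss_cone A a x"
  defines "s \<equiv> 1 - exp (- 2 * t\<^sup>2)"
  defines "H \<equiv> 2 * ((A + a + A * a\<^sup>2) * exp (a\<^sup>2)) + 4 * a"
  shows "mehler_kernel (t\<^sup>2) y \<xi> \<le>
    exp ((norm x)\<^sup>2 + (H + b)\<^sup>2 * exp (2 * a\<^sup>2)) / sqrt s ^ DIM('a) *
      exp (- b * (norm (\<xi> - x) / sqrt s))"
    and "norm x * sqrt s \<le> 2 * a" and "s > 0"
proof -
  have t: "t > 0" and xy: "norm (x - y) < A * t" and ta: "t \<le> a * cutoff x"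
    using yt by (auto simp: gauss_cone_def)
  \<comment> \<open>The two branches of the cut-off give two separate bounds: \<open>t <= a\<close>
    and \<open>t * norm x <= a\<close>.\<close>
  have "t \<le> a * 1"
    using ta assms(2) by (intro order_trans[OF ta] mult_left_mono) (auto simp: cutoff_def)
  then have t_le: "t \<le> a" by simp
  have tx: "t * norm x \<le> a"
  proof (cases "x = 0")
    case False
    then have "t \<le> a * (1 / norm x)"
      using assms(2) by (intro order_trans[OF ta] mult_left_mono) (auto simp: cutoff_def)
    with False show ?thesis by (simp add: field_simps)
  qed (use assms in auto)
  show "s > 0" using t by (simp add: s_def)
  define q where "q = sqrt s"
  have q: "q > 0" "q\<^sup>2 = s" using \<open>s > 0\<close> by (auto simp: q_def)
  have "s \<le> 2 * t\<^sup>2"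
    using exp_ge_add_one_self[of "- 2 * t\<^sup>2"] by (simp add: s_def)
  then have "q\<^sup>2 \<le> (2 * t)\<^sup>2" unfolding q power_mult_distrib by (rule order_trans) simp
  then have q2t: "q \<le> 2 * t" using t by (intro power2_le_imp_le[of q]) auto
  have "norm x * q \<le> norm x * (2 * t)" using q2t by (intro mult_left_mono) auto
  with tx show xq: "norm x * sqrt s \<le> 2 * a" by (simp add: q_def algebra_simps)
  have t2: "t\<^sup>2 \<le> a\<^sup>2" using t t_le by (intro power_mono) auto
  \<comment> \<open>With v = 2 t^2, the inequality 1 + v <= exp v yields v exp (-v) <= s. Since t <=
    a, this bounds t by a multiple of sqrt s, the converse of \<open>q2t\<close>.\<close>
  have "(1 + 2 * t\<^sup>2) * exp (- 2 * t\<^sup>2) \<le> exp (2 * t\<^sup>2) * exp (- 2 * t\<^sup>2)"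
    by (intro mult_right_mono) auto
  then have "2 * t\<^sup>2 * exp (- 2 * t\<^sup>2) \<le> s"
    by (simp add: s_def algebra_simps flip: exp_add)
  moreover have "t\<^sup>2 * exp (- 2 * a\<^sup>2) \<le> 2 * t\<^sup>2 * exp (- 2 * t\<^sup>2)"
    using t2 t by (intro mult_mono) auto
  ultimately have "t\<^sup>2 * exp (- 2 * a\<^sup>2) * exp (2 * a\<^sup>2) \<le> s * exp (2 * a\<^sup>2)"
    by (intro mult_right_mono) auto
  then have "t\<^sup>2 \<le> (q * exp (a\<^sup>2))\<^sup>2"
    using q by (simp add: power_mult_distrib mult.assoc flip: exp_add exp_double)
  then have tq: "t \<le> q * exp (a\<^sup>2)"
    using q by (intro power2_le_imp_le[of t]) auto

  \<comment> \<open>As a function of \<open>\<xi>\<close>, the Gaussian factor of the kernel is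
    centred at \<open>z\<close>; \<open>\<rho>\<close> is the distance from x in units of sqrt
    s.\<close>
  define z where "z = exp (- t\<^sup>2) *\<^sub>R y"
  define D where "D = (A + a + A * a\<^sup>2) * exp (a\<^sup>2)"
  define \<rho> where "\<rho> = norm (\<xi> - x) / q"
  have \<rho>: "\<rho> \<ge> 0" "norm (\<xi> - x) = \<rho> * q" using q by (auto simp: \<rho>_def)
  \<comment> \<open>Go from x to z through y. The cone contributes A t, the contraction at most t^2
    (|x| + A t); the bound t |x| <= a makes the latter linear in t.\<close>
  have xz: "norm (x - z) \<le> D * q"
  proof -
    have "norm y \<le> norm x + A * t"
      using xy norm_triangle_ineq3[of x y] by linarith
    moreover have "1 - exp (- t\<^sup>2) \<le> t\<^sup>2"
      using exp_ge_add_one_self[of "- t\<^sup>2"] by linarith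
    ultimately have "(1 - exp (- t\<^sup>2)) * norm y \<le> t\<^sup>2 * (norm x + A * t)"
      by (intro mult_mono) auto
    also have "\<dots> = t * (t * norm x) + A * t\<^sup>2 * t"
      by (simp add: power2_eq_square algebra_simps)
    also have "\<dots> \<le> t * a + A * a\<^sup>2 * t"
      using tx t t2 assms by (intro add_mono mult_left_mono mult_right_mono) auto
    finally have "(1 - exp (- t\<^sup>2)) * norm y \<le> t * a + A * a\<^sup>2 * t" .
    moreover have xz_eq: "x - z = (x - y) + (1 - exp (- t\<^sup>2)) *\<^sub>R y"
      by (simp add: z_def algebra_simps)
    have "norm (x - z) \<le> norm (x - y) + (1 - exp (- t\<^sup>2)) * norm y"
      unfolding xz_eq
      using norm_triangle_ineq[of "x - y" "(1 - exp (- t\<^sup>2)) *\<^sub>R y"] by simp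
    ultimately have "norm (x - z) \<le> (A + a + A * a\<^sup>2) * t"
      using xy by (simp add: algebra_simps)
    also have "\<dots> \<le> (A + a + A * a\<^sup>2) * (q * exp (a\<^sup>2))"
      using tq assms by (intro mult_left_mono) auto
    finally show ?thesis by (simp add: D_def algebra_simps)
  qed
  \<comment> \<open>Square the reverse triangle inequality and drop only \<open>\<delta>^2\<close>.
    The coefficient of \<open>\<rho>^2\<close> must remain exactly 1, because it competes with the
    coefficient \<open>s\<close> in \<open>nxi\<close>.\<close>
  have zxi: "(\<rho>\<^sup>2 - 2 * D * \<rho>) * s \<le> (norm (z - \<xi>))\<^sup>2"
  proof -
    define \<delta> where "\<delta> = norm (x - z)"
    have "\<bar>\<rho> * q - \<delta>\<bar> \<le> norm (z - \<xi>)"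
      using norm_triangle_ineq3[of "\<xi> - x" "z - x"] \<rho>
      by (simp add: \<delta>_def norm_minus_commute)
    then have "(\<rho> * q - \<delta>)\<^sup>2 \<le> (norm (z - \<xi>))\<^sup>2"
      by (metis abs_le_square_iff abs_norm_cancel)
    moreover have "\<rho> * q * \<delta> \<le> \<rho> * q * (D * q)"
      using xz \<rho> q by (intro mult_left_mono) (auto simp: \<delta>_def)
    moreover have "(\<rho> * q - \<delta>)\<^sup>2 = \<rho>\<^sup>2 * s - 2 * (\<rho> * q * \<delta>) + \<delta>\<^sup>2"
      and "(\<rho>\<^sup>2 - 2 * D * \<rho>) * s = \<rho>\<^sup>2 * s - 2 * (\<rho> * q * (D * q))"
      by (simp_all add: power2_eq_square algebra_simps flip: q(2))
    ultimately show ?thesis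
      using zero_le_power2[of \<delta>] by linarith
  qed
  have nxi: "(norm \<xi>)\<^sup>2 \<le> (norm x)\<^sup>2 + 4 * a * \<rho> + s * \<rho>\<^sup>2"
  proof -
    have "norm \<xi> \<le> norm x + \<rho> * q"
      using norm_triangle_ineq[of x "\<xi> - x"] \<rho> by simp
    then have "(norm \<xi>)\<^sup>2 \<le> (norm x + \<rho> * q)\<^sup>2" by (intro power_mono) auto
    also have "\<dots> = (norm x)\<^sup>2 + 2 * (norm x * q) * \<rho> + s * \<rho>\<^sup>2"
      by (simp add: power2_eq_square algebra_simps flip: q(2))
    also have "\<dots> \<le> (norm x)\<^sup>2 + 2 * (2 * a) * \<rho> + s * \<rho>\<^sup>2"
      using xq \<rho> by (intro add_mono mult_right_mono mult_left_mono) (auto simp: q_def)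
    finally show ?thesis by simp
  qed
  define e where "e = exp (- 2 * a\<^sup>2)"
  have e: "e > 0" "s \<le> 1 - e" using t2 by (auto simp: e_def s_def)
  \<comment> \<open>The quadratic term survives because \<open>s\<close> stays away from \<open>1\<close>; it absorbs any linear term.\<close>
  have square: "- (e * \<rho>\<^sup>2) + (H + b) * \<rho> \<le> (H + b)\<^sup>2 * exp (2 * a\<^sup>2)"
  proof -
    \<comment> \<open>Completing the square gives the maximum (H + b)^2 / (4 e). The factor 1/4 is
      given away, and 1 / e is \<open>exp (2 * a^2)\<close>.\<close>
    have "0 \<le> (e * \<rho> - (H + b) / 2)\<^sup>2" by simp
    then have "e * (- (e * \<rho>\<^sup>2) + (H + b) * \<rho>) \<le> (H + b)\<^sup>2 / 4"
      by (simp add: power2_eq_square field_simps)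
    also have "\<dots> \<le> (H + b)\<^sup>2" by simp
    also have "\<dots> = e * ((H + b)\<^sup>2 * exp (2 * a\<^sup>2))"
      by (simp add: e_def mult.left_commute flip: exp_add)
    finally show ?thesis using e by simp
  qed
  have "- ((norm (z - \<xi>))\<^sup>2 / s) \<le> - (\<rho>\<^sup>2 - 2 * D * \<rho>)"
    unfolding neg_le_iff_le pos_le_divide_eq[OF \<open>s > 0\<close>] by (rule zxi)
  moreover have "s * \<rho>\<^sup>2 \<le> (1 - e) * \<rho>\<^sup>2"
    using e by (intro mult_right_mono) auto
  \<comment> \<open>The quadratic terms combine to at most \<open>- e * \<rho>^2\<close> and the
    linear ones to \<open>H * \<rho>\<close>; adding and subtracting \<open>b * \<rho>\<close> makes
    \<open>square\<close> applicable.\<close>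
  ultimately have exponent: "- ((norm (z - \<xi>))\<^sup>2 / s) + (norm \<xi>)\<^sup>2 \<le>
      (norm x)\<^sup>2 + (H + b)\<^sup>2 * exp (2 * a\<^sup>2) + - b * \<rho>"
    using square nxi by (simp add: algebra_simps H_def D_def)
  have pow: "s powr (real DIM('a) / 2) = q ^ DIM('a)"
    using \<open>s > 0\<close> by (simp add: q_def powr_half_sqrt[symmetric] powr_powr flip: powr_realpow)
  have "mehler_kernel (t\<^sup>2) y \<xi> =
      exp (- ((norm (z - \<xi>))\<^sup>2 / s) + (norm \<xi>)\<^sup>2) / q ^ DIM('a)"
    unfolding mehler_kernel_def s_def[symmetric] z_def[symmetric] exp_add pow by simp
  also have "\<dots> \<le> exp ((norm x)\<^sup>2 + (H + b)\<^sup>2 * exp (2 * a\<^sup>2) + - b * \<rho>) / q ^ DIM('a)"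
    using exponent q by (intro divide_right_mono) auto
  finally show "mehler_kernel (t\<^sup>2) y \<xi> \<le>
    exp ((norm x)\<^sup>2 + (H + b)\<^sup>2 * exp (2 * a\<^sup>2)) / sqrt s ^ DIM('a) *
      exp (- b * (norm (\<xi> - x) / sqrt s))"
    by (simp only: exp_add times_divide_eq_left \<rho>_def q_def)
qed

lemma mehler_kernel_nonneg: "mehler_kernel t x \<xi> \<ge> 0"
  by (simp add: mehler_kernel_def)

text \<open>If the integrand is not integrable, the Bochner integral is 0 by convention and the
  bound is trivial. From here on, convergence is handled in \<open>ennreal\<close>.\<close>

lemma ou_semigroup_le:
  fixes u :: "'a::euclidean_space \<Rightarrow> 'b::{banach, second_countable_topology}"
  shows "ennreal (norm (ou_semigroup t u y)) \<le>
    (\<integral>\<^sup>+\<xi>. ennreal (mehler_kernel t y \<xi>) * ennreal (norm (u \<xi>)) \<partial>gauss_measure)"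
proof (cases "integrable gauss_measure (\<lambda>\<xi>. mehler_kernel t y \<xi> *\<^sub>R u \<xi>)")
  case True
  from integral_norm_bound_ennreal[OF this] show ?thesis
    by (simp add: ou_semigroup_def ennreal_mult mehler_kernel_nonneg)
next
  case False
  then show ?thesis by (simp add: ou_semigroup_def not_integrable_integral_eq)
qed

text \<open>The single term with k the floor of the scaled distance already dominates; the open ball
  needs radius k + 1. Full balls replace annuli because the maximal function averages over
  balls.\<close>

lemma exp_minus_le_suminf_indicator:
  fixes x \<xi> :: "'a::euclidean_space"
  assumes "q > 0" "b \<ge> 0"
  shows "ennreal (exp (- b * (norm (\<xi> - x) / q))) \<le>
    (\<Sum>k. ennreal (exp (- b * real k)) * indicator (ball x (real (Suc k) * q)) \<xi>)"
proof -
  define k where "k = nat \<lfloor>norm (\<xi> - x) / q\<rfloor>"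
  have k: "real k \<le> norm (\<xi> - x) / q" "norm (\<xi> - x) / q < real (Suc k)"
    using assms by (simp_all add: k_def)
      (metis add.commute real_of_int_floor_add_one_gt)
  then have "\<xi> \<in> ball x (real (Suc k) * q)"
    using assms by (simp add: dist_norm norm_minus_commute pos_divide_less_eq)
  then have "ennreal (exp (- b * (norm (\<xi> - x) / q))) \<le>
      ennreal (exp (- b * real k)) * indicator (ball x (real (Suc k) * q)) \<xi>"
    using mult_left_mono[OF k(1) assms(2)] by (auto intro!: ennreal_leI)
  also have "\<dots> \<le> (\<Sum>k. ennreal (exp (- b * real k)) * indicator (ball x (real (Suc k) * q)) \<xi>)"
    using sum_le_suminf[OF summableI, of "{k}"] by fastforce
  finally show ?thesis .
qed

theorem theorem1:
  fixes A a :: real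
  assumes "A > 0" and "a > 0"
  shows "\<exists>C::real. C > 0 \<and>
    (\<forall>(x::'a::euclidean_space). \<forall>u\<in>(Cc :: ('a \<Rightarrow> complex) set).
       (SUP (y, t)\<in>gauss_cone A a x. ennreal (norm (ou_semigroup (t\<^sup>2) u y)))
         \<le> ennreal C *
            (SUP r\<in>{0<..}. ennreal
               (1 / measure gauss_measure (ball x r) *
                (LINT y:ball x r|gauss_measure. norm (u y)))))"
proof -
  let ?d = "DIM('a)"
  \<comment> \<open>\<open>4 * a\<close> offsets the exponential growth of the Gaussian measures of
    the balls, d offsets (k + 1)^d <= exp (d k), and the remaining 1 leaves the geometric ratio
    \<open>exp (- 1)\<close>.\<close>
  define b where "b = 4 * a + real ?d + 1"
  define Q where
    "Q = (2 * ((A + a + A * a\<^sup>2) * exp (a\<^sup>2)) + 4 * a + b)\<^sup>2 * exp (2 * a\<^sup>2)"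
  \<comment> \<open>The extra \<open>4 * a\<close> in the exponent is the k-independent part of 4 a
    (k + 1).\<close>
  define W where "W = exp (Q + 4 * a) * pi powr (- (real ?d / 2)) * unit_ball_vol (real ?d)"
  define C where "C = W * (\<Sum>k. exp (- 1) ^ k)"
  have W: "W > 0" by (simp add: W_def)
  have geo: "summable (\<lambda>k. exp (- 1 :: real) ^ k)" by (rule summable_geometric) simp
  have C: "C > 0"
    unfolding C_def using W suminf_pos[OF geo] by simp
  have "ennreal (norm (ou_semigroup (t\<^sup>2) u y)) \<le> ennreal C *
      (SUP r\<in>{0<..}. ennreal (1 / measure gauss_measure (ball x r) *
         (LINT y:ball x r|gauss_measure. norm (u y))))" (is "_ \<le> _ * ?S")
    if u: "u \<in> Cc" and yt: "(y, t) \<in> gauss_cone A a x"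
    for x y :: 'a and t and u :: "'a \<Rightarrow> complex"
  proof -
    define s where "s = 1 - exp (- 2 * t\<^sup>2)"
    define q where "q = sqrt s"
    define N where "N = exp ((norm x)\<^sup>2 + Q) / q ^ ?d"
    define c where "c k = N * exp (- b * real k)" for k
    let ?B = "\<lambda>k. ball x (real (Suc k) * q)"
    note kernel = mehler_kernel_le[OF assms yt, folded s_def]
    have q: "q > 0" and xq: "norm x * q \<le> 2 * a"
      using kernel(2,3) by (auto simp: q_def)
    have N: "N > 0" using q by (simp add: N_def)
    have b: "b \<ge> 0" using assms by (simp add: b_def)
    have cont: "continuous_on UNIV u" using u by (simp add: Cc_def)
    have [measurable]: "u \<in> borel_measurable borel"
      using cont by (rule borel_measurable_continuous_onI)
    \<comment> \<open>All dependence on x and t cancels: exp (|x|^2) against exp (-|x|^2), and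
      q^(-d) against q^d. This is why the final constant is uniform.\<close>
    have coeff: "ennreal (c k) * emeasure gauss_measure (?B k) \<le> ennreal (W * exp (- 1) ^ k)" for k
    proof -
      let ?r = "real (Suc k) * q"
      have "real (Suc k) ^ ?d \<le> exp (real k) ^ ?d"
        using exp_ge_add_one_self[of "real k"] by (intro power_mono) auto
      then have growth: "real (Suc k) ^ ?d \<le> exp (real ?d * real k)"
        by (simp add: exp_of_nat_mult)
      have "2 * norm x * ?r \<le> 4 * a * real (Suc k)"
        using mult_right_mono[OF xq, of "2 * real (Suc k)"] by (simp add: algebra_simps)
      then have ex: "exp (2 * norm x * ?r - (norm x)\<^sup>2) \<le> exp (4 * a * real (Suc k) - (norm x)\<^sup>2)"
        by simp
      have "c k * (pi powr (- (real ?d / 2)) * exp (2 * norm x * ?r - (norm x)\<^sup>2) *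
          (unit_ball_vol (real ?d) * ?r ^ ?d)) \<le>
        c k * (pi powr (- (real ?d / 2)) * exp (4 * a * real (Suc k) - (norm x)\<^sup>2) *
          (unit_ball_vol (real ?d) * (exp (real ?d * real k) * q ^ ?d)))"
        using N q growth ex unfolding power_mult_distrib
        by (intro mult_left_mono mult_right_mono mult_mono) (auto simp: c_def)
      also have "\<dots> = pi powr (- (real ?d / 2)) * unit_ball_vol (real ?d) *
          (exp ((norm x)\<^sup>2 + Q) * exp (- b * real k) * exp (4 * a * real (Suc k) - (norm x)\<^sup>2) *
           exp (real ?d * real k))"
        using q by (simp add: c_def N_def)
      also have "\<dots> = W * exp (- 1) ^ k"
        unfolding W_def exp_of_nat_mult[symmetric] exp_add[symmetric]
        by (simp add: b_def algebra_simps flip: exp_add exp_of_nat_mult)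
      finally have "c k * (pi powr (- (real ?d / 2)) * exp (2 * norm x * ?r - (norm x)\<^sup>2) *
          (unit_ball_vol (real ?d) * ?r ^ ?d)) \<le> W * exp (- 1) ^ k" .
      moreover have "ennreal (c k) * emeasure gauss_measure (?B k) \<le> ennreal (c k) *
          ennreal (pi powr (- (real ?d / 2)) * exp (2 * norm x * ?r - (norm x)\<^sup>2) *
          (unit_ball_vol (real ?d) * ?r ^ ?d))"
        using q by (intro mult_left_mono emeasure_gauss_ball_le) auto
      ultimately show ?thesis
        using N by (subst (asm) ennreal_mult'[symmetric])
          (auto simp: c_def intro: order_trans ennreal_leI)
    qed
    \<comment> \<open>Each ball has positive radius, so its average is one of those in the supremum
      \<open>?S\<close>, which does not depend on k.\<close>
    have avg: "ennreal (c k) * (\<integral>\<^sup>+\<xi>. ennreal (norm (u \<xi>)) * indicator (?B k) \<xi> \<partial>gauss_measure) \<le>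
        ennreal (W * exp (- 1) ^ k) * ?S" for k
    proof -
      have r: "real (Suc k) * q \<in> {0<..}" using q by simp
      show ?thesis
        unfolding nn_integral_gauss_ball[OF cont r[unfolded greaterThan_iff]] mult.assoc[symmetric]
        by (intro mult_mono coeff SUP_upper r) auto
    qed
    have "ennreal (norm (ou_semigroup (t\<^sup>2) u y)) \<le>
        (\<integral>\<^sup>+\<xi>. ennreal (mehler_kernel (t\<^sup>2) y \<xi>) * ennreal (norm (u \<xi>)) \<partial>gauss_measure)"
      by (rule ou_semigroup_le)
    also have "\<dots> \<le> (\<integral>\<^sup>+\<xi>. (\<Sum>k. ennreal (c k) *
        (ennreal (norm (u \<xi>)) * indicator (?B k) \<xi>)) \<partial>gauss_measure)"
    proof (rule nn_integral_mono)
      fix \<xi> :: 'a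
      have "ennreal (mehler_kernel (t\<^sup>2) y \<xi>) \<le>
          ennreal (N * exp (- b * (norm (\<xi> - x) / q)))"
        using kernel(1)[of \<xi> b] by (intro ennreal_leI) (simp add: N_def Q_def q_def)
      also have "\<dots> = ennreal N * ennreal (exp (- b * (norm (\<xi> - x) / q)))"
        using N by (simp add: ennreal_mult)
      also have "\<dots> \<le> ennreal N * (\<Sum>k. ennreal (exp (- b * real k)) * indicator (?B k) \<xi>)"
        using q b by (intro mult_left_mono exp_minus_le_suminf_indicator) auto
      also have "\<dots> = (\<Sum>k. ennreal (c k) * indicator (?B k) \<xi>)"
        using N by (simp add: c_def ennreal_mult mult.assoc del: mult_minus_left flip: ennreal_suminf_cmult)
      finally have "ennreal (mehler_kernel (t\<^sup>2) y \<xi>) * ennreal (norm (u \<xi>)) \<le>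
          (\<Sum>k. ennreal (c k) * indicator (?B k) \<xi>) * ennreal (norm (u \<xi>))"
        by (rule mult_right_mono) simp
      then show "ennreal (mehler_kernel (t\<^sup>2) y \<xi>) * ennreal (norm (u \<xi>)) \<le>
          (\<Sum>k. ennreal (c k) * (ennreal (norm (u \<xi>)) * indicator (?B k) \<xi>))"
        unfolding ennreal_suminf_multc[symmetric] by (simp only: mult_ac)
    qed
    \<comment> \<open>Monotone convergence exchanges sum and integral, all terms being nonnegative
      and measurable.\<close>
    also have "\<dots> = (\<Sum>k. ennreal (c k) *
        (\<integral>\<^sup>+\<xi>. ennreal (norm (u \<xi>)) * indicator (?B k) \<xi> \<partial>gauss_measure))"
    proof -
      have [measurable]: "?B k \<in> sets borel" for k
        by simp
      show ?thesis
        by (subst nn_integral_suminf, measurable, subst nn_integral_cmult, measurable)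
    qed
    also have "\<dots> \<le> (\<Sum>k. ennreal (W * exp (- 1) ^ k) * ?S)"
      by (intro suminf_le avg summableI)
    also have "\<dots> = (\<Sum>k. ennreal (W * exp (- 1) ^ k)) * ?S"
      by (rule ennreal_suminf_multc)
    also have "(\<Sum>k. ennreal (W * exp (- 1) ^ k)) = ennreal C"
      using W geo unfolding C_def suminf_mult[OF geo, symmetric]
      by (intro suminf_ennreal2 summable_mult) auto
    finally show ?thesis .
  qed
  with C show ?thesis
    by (intro exI[of _ C]) (auto intro!: SUP_least)
qed

end
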